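(* Identify $O_q$ with the subalgebra $\langle \mathcal W_0,\mathcal W_1\rangle$ of $\mathcal O_q$ via the injective algebra homomorphism $\imath:O_q\to\mathcal O_q$, $W_0\mapsto\mathcal W_0$, $W_1\mapsto \mathcal W_1$. Then for the algebra $\mathcal O_q$, \begin{align*} \frac{q+q^{-1}}{t+t^{-1}}\,\mathcal W^-\Bigl(\frac{q+q^{-1}}{t+t^{-1}}\Bigr) &= \mathcal{\tilde G}\Bigl(\frac{q+q^{-1}}{t+t^{-1}}\Bigr)\,\frac{qtB^+(qt)+B^-(q^{-1}t)}{(q^2-q^{-2})(t-t^{-1})},\\ \frac{q+q^{-1}}{t+t^{-1}}\,\mathcal W^+\Bigl(\frac{q+q^{-1}}{t+t^{-1}}\Bigr) &= \mathcal{\tilde G}\Bigl(\frac{q+q^{-1}}{t+t^{-1}}\Bigr)\,\frac{B^+(qt)+q^{-1}tB^-(q^{-1}t)}{(q^2-q^{-2})(t-t^{-1})}. \end{align*}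
   Context: $\mathbb F$ is a field; $q\in\mathbb F$ is nonzero and not a root of unity; $\mathbb N=\{0,1,2,\ldots\}$; $[n]_q=(q^n-q^{-n})/(q-q^{-1})$. Algebras are associative, unital, over $\mathbb F$. $[X,Y]=XY-YX$ and $[X,Y]_r=rXY-r^{-1}YX$ for nonzero $r \in \mathbb F$. The $q$-Onsager algebra $O_q$ has generators $W_0,W_1$ and relations $[W_0,[W_0,[W_0,W_1]_q]_{q^{-1}}]=(q^2-q^{-2})^2[W_1,W_0]$ and $[W_1,[W_1,[W_1,W_0]_q]_{q^{-1}}]=(q^2-q^{-2})^2[W_0,W_1]$. Elements of $O_q$: $B_\delta=q^{-2}W_1W_0-W_0W_1$; with $c=q/((q-q^{-1})(q^2-q^{-2}))$: $B_{\alpha_0}=W_0$, $B_{\delta+\alpha_0}=W_1+c[B_\delta,W_0]$, $B_{n\delta+\alpha_0}=B_{(n-2)\delta+\alpha_0}+c[B_\delta,B_{(n-1)\delta+\alpha_0}]$ for $n\ge2$; $B_{\alpha_1}=W_1$, $B_{\delta+\alpha_1}=W_0-c[B_\delta,W_1]$, $B_{n\delta+\alpha_1}=B_{(n-2)\delta+\alpha_1}-c[B_\delta,B_{(n-1)\delta+\alpha_1}]$ for $n\ge 2$. Set $B^-(t)=\sum_{n\in\mathbb N}B_{n\delta+\alpha_0}t^n$, $B^+(t)=\sum_{n\in\mathbb N}B_{n\delta+\alpha_1}t^n$. The algebra $\mathcal O_q$ has generators $\mathcal W_{-k},\mathcal W_{k+1},\mathcal G_{k+1},\mathcal{\tilde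 G}_{k+1}$ ($k\in\mathbb N$) and the following relations for $k,\ell\in\mathbb N$, where $\rho=-(q^2-q^{-2})^2$: $[\mathcal W_0,\mathcal W_{k+1}]=[\mathcal W_{-k},\mathcal W_1]=(\mathcal{\tilde G}_{k+1}-\mathcal G_{k+1})/(q+q^{-1})$; $[\mathcal W_0,\mathcal G_{k+1}]_q=[\mathcal{\tilde G}_{k+1},\mathcal W_0]_q=\rho\mathcal W_{-k-1}-\rho\mathcal W_{k+1}$; $[\mathcal G_{k+1},\mathcal W_1]_q=[\mathcal W_1,\mathcal{\tilde G}_{k+1}]_q=\rho\mathcal W_{k+2}-\rho\mathcal W_{-k}$; $[\mathcal W_{-k},\mathcal W_{-\ell}]=0$; $[\mathcal W_{k+1},\mathcal W_{\ell+1}]=0$; $[\mathcal W_{-k},\mathcal W_{\ell+1}]+[\mathcal W_{k+1},\mathcal W_{-\ell}]=0$; $[\mathcal W_{-k},\mathcal G_{\ell+1}]+[\mathcal G_{k+1},\mathcal W_{-\ell}]=0$; $[\mathcal W_{-k},\mathcal{\tilde G}_{\ell+1}]+[\mathcal{\tilde G}_{k+1},\mathcal W_{-\ell}]=0$; $[\mathcal W_{k+1},\mathcal G_{\ell+1}]+[\mathcal G_{k+1},\mathcal W_{\ell+1}]=0$; $[\mathcal W_{k+1},\mathcal{\tilde G}_{\ell+1}]+[\mathcal{\tilde G}_{k+1},\mathcal W_{\ell+1}]=0$; $[\mathcal G_{k+1},\mathcal G_{\ell+1}]=0$; $[\mathcal{\tilde G}_{k+1},\mathcal{\tilde G}_{\ell+1}]=0$;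 $[\mathcal{\tilde G}_{k+1},\mathcal G_{\ell+1}]+[\mathcal G_{k+1},\mathcal{\tilde G}_{\ell+1}]=0$. Also $\mathcal G_0=\mathcal{\tilde G}_0=-(q-q^{-1})[2]_q^2$. Set $\mathcal W^-(t)=\sum_{n\in\mathbb N}\mathcal W_{-n}t^n$, $\mathcal W^+(t)=\sum_{n\in\mathbb N}\mathcal W_{n+1}t^n$, $\mathcal{\tilde G}(t)=\sum_{n\in\mathbb N}\mathcal{\tilde G}_nt^n$. It is known from earlier work that $\imath$ exists and is injective. Identities are between formal power series in $t$ over $\mathcal O_q$; $\frac{q+q^{-1}}{t+t^{-1}}$ means the series $(q+q^{-1})\sum_{\ell\in\mathbb N}(-1)^\ell t^{2\ell+1}$, and $(t-t^{-1})^{-1}$ means $-\sum_{\ell\in\mathbb N}t^{2\ell+1}$. *)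

theory Defs
  imports "HOL-Computational_Algebra.Formal_Power_Series" "HOL-Library.Poly_Mapping"
begin

section \<open>Algebras given by generators and relations\<close>

locale unital_algebra = vector_space scale
  for scale :: "'f::field \<Rightarrow> 'a::ring_1 \<Rightarrow> 'a" +
  assumes scale_mult_left: "scale c x * y = scale c (x * y)"
    and scale_mult_right: "x * scale c y = scale c (x * y)"

definition algebra_hom ::
    "('f::field \<Rightarrow> 'a::ring_1 \<Rightarrow> 'a) \<Rightarrow> ('f \<Rightarrow> 'b::ring_1 \<Rightarrow> 'b) \<Rightarrow> ('a \<Rightarrow> 'b) \<Rightarrow> bool" where
  "algebra_hom sA sB f \<longleftrightarrow>
     unital_algebra sA \<and> unital_algebra sB \<and> Vector_Spaces.linear sA sB f \<and>
     f 1 = 1 \<and> (\<forall>x y. f (x * y) = f x * f y)"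

text \<open>
  The free monoid on \<open>'x\<close>, written additively (\<open>+\<close> is concatenation of words), so that
  the convolution product on \<open>'x free_word \<Rightarrow>\<^sub>0 'f\<close> makes this type
  the free unital associative algebra on \<open>'x\<close> over \<open>'f\<close>.
\<close>

datatype 'x free_word = Free_Word (letters: "'x list")

instantiation free_word :: (type) monoid_add
begin

definition zero_free_word :: "'a free_word" where
  "0 = Free_Word []"

definition plus_free_word :: "'a free_word \<Rightarrow> 'a free_word \<Rightarrow> 'a free_word" where
  "u + v = Free_Word (letters u @ letters v)"

instance
  by standard (simp_all add: zero_free_word_def plus_free_word_def)

end

definition free_scale ::
    "'f::field \<Rightarrow> ('x free_word \<Rightarrow>\<^sub>0 'f) \<Rightarrow> ('x free_word \<Rightarrow>\<^sub>0 'f)" where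
  "free_scale c p = Poly_Mapping.single 0 c * p"

definition free_gen :: "'x \<Rightarrow> ('x free_word \<Rightarrow>\<^sub>0 'f::field)" where
  "free_gen x = Poly_Mapping.single (Free_Word [x]) 1"

definition free_eval ::
    "('f::field \<Rightarrow> 'a::ring_1 \<Rightarrow> 'a) \<Rightarrow> ('x \<Rightarrow> 'a) \<Rightarrow> ('x free_word \<Rightarrow>\<^sub>0 'f) \<Rightarrow> 'a" where
  "free_eval scale g p =
     (\<Sum>w\<in>Poly_Mapping.keys p. scale (Poly_Mapping.lookup p w) (prod_list (map g (letters w))))"

definition two_sided_ideal :: "'a::ring_1 set \<Rightarrow> bool" where
  "two_sided_ideal I \<longleftrightarrow>
     0 \<in> I \<and> (\<forall>x\<in>I. \<forall>y\<in>I. x + y \<in> I) \<and> (\<forall>a. \<forall>x\<in>I. a * x \<in> I \<and> x * a \<in> I)"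

text \<open>
  The algebra on \<open>'a\<close> with scalar multiplication \<open>scale\<close> is the algebra with
  generators \<open>g x\<close> and relations \<open>l = r\<close> for \<open>(l, r) \<in> R\<close>: evaluation at \<open>g\<close> induces an
  isomorphism from the free algebra modulo the two-sided ideal generated by all \<open>l - r\<close>.
\<close>

definition presented_algebra ::
    "('f::field \<Rightarrow> 'a::ring_1 \<Rightarrow> 'a) \<Rightarrow> ('x \<Rightarrow> 'a) \<Rightarrow>
     (('x free_word \<Rightarrow>\<^sub>0 'f) \<times> ('x free_word \<Rightarrow>\<^sub>0 'f)) set \<Rightarrow> bool" where
  "presented_algebra scale g R \<longleftrightarrow>
     unital_algebra scale \<and>
     surj (free_eval scale g) \<and>
     {p. free_eval scale g p = 0} = two_sided_ideal hull ((\<lambda>(l, r). l - r) ` R)"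

definition comm :: "'a::ring_1 \<Rightarrow> 'a \<Rightarrow> 'a" where
  "comm X Y = X * Y - Y * X"

definition rcomm :: "('f::field \<Rightarrow> 'a::ring_1 \<Rightarrow> 'a) \<Rightarrow> 'f \<Rightarrow> 'a \<Rightarrow> 'a \<Rightarrow> 'a" where
  "rcomm scale r X Y = scale r (X * Y) - scale (inverse r) (Y * X)"

definition qint :: "'f::field \<Rightarrow> nat \<Rightarrow> 'f" where
  "qint q n = (q ^ n - inverse q ^ n) / (q - inverse q)"

section \<open>The $q$-Onsager algebra\<close>

datatype onsager_gen = W0 | W1

definition onsager_rels ::
    "'f::field \<Rightarrow> ((onsager_gen free_word \<Rightarrow>\<^sub>0 'f) \<times> (onsager_gen free_word \<Rightarrow>\<^sub>0 'f)) set" where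
  "onsager_rels q =
     (let w0 = free_gen W0; w1 = free_gen W1;
          qc = rcomm free_scale q; qc' = rcomm free_scale (inverse q);
          d = (q powi 2 - q powi (-2)) ^ 2
      in {(comm w0 (qc' w0 (qc w0 w1)), free_scale d (comm w1 w0)),
          (comm w1 (qc' w1 (qc w1 w0)), free_scale d (comm w0 w1))})"

context
  fixes scale :: "'f::field \<Rightarrow> 'o::ring_1 \<Rightarrow> 'o" and q :: 'f and g :: "onsager_gen \<Rightarrow> 'o"
begin

definition B_delta :: 'o where
  "B_delta = scale (q powi (-2)) (g W1 * g W0) - g W0 * g W1"

definition B_const :: 'f where
  "B_const = q / ((q - inverse q) * (q powi 2 - q powi (-2)))"

text \<open>\<open>B_alpha0 n\<close> and \<open>B_alpha1 n\<close> are $B_{n\delta+\alpha_0}$ and $B_{n\delta+\alpha_1}$.\<close>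

fun B_alpha0 :: "nat \<Rightarrow> 'o" where
  "B_alpha0 0 = g W0"
| "B_alpha0 (Suc 0) = g W1 + scale B_const (comm B_delta (g W0))"
| "B_alpha0 (Suc (Suc n)) = B_alpha0 n + scale B_const (comm B_delta (B_alpha0 (Suc n)))"

fun B_alpha1 :: "nat \<Rightarrow> 'o" where
  "B_alpha1 0 = g W1"
| "B_alpha1 (Suc 0) = g W0 - scale B_const (comm B_delta (g W1))"
| "B_alpha1 (Suc (Suc n)) = B_alpha1 n - scale B_const (comm B_delta (B_alpha1 (Suc n)))"

end

section \<open>The algebra $\mathcal{O}_q$\<close>

text \<open>
  \<open>CW n\<close> is $\mathcal{W}_n$ for every integer \<open>n\<close>: the families $\mathcal{W}_{-k}$ and
  $\mathcal{W}_{k+1}$ ($k \in \mathbb{N}$) together use each integer index exactly once.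
  The indices of the other two families are shifted: \<open>CG k\<close> is $\mathcal{G}_{k+1}$ and
  \<open>CGt k\<close> is $\tilde{\mathcal{G}}_{k+1}$. In \<open>alt_rels\<close>, \<open>Wm k\<close> and \<open>Wp k\<close> are
  $\mathcal{W}_{-k}$ and $\mathcal{W}_{k+1}$.
\<close>

datatype alt_gen = CW int | CG nat | CGt nat

definition alt_rels ::
    "'f::field \<Rightarrow> ((alt_gen free_word \<Rightarrow>\<^sub>0 'f) \<times> (alt_gen free_word \<Rightarrow>\<^sub>0 'f)) set" where
  "alt_rels q =
     (let Wm = (\<lambda>k::nat. free_gen (CW (- int k)));
          Wp = (\<lambda>k::nat. free_gen (CW (int k + 1)));
          G = (\<lambda>k::nat. free_gen (CG k));
          Gt = (\<lambda>k::nat. free_gen (CGt k));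
          qc = rcomm free_scale q;
          \<rho> = - ((q powi 2 - q powi (-2)) ^ 2)
      in (\<Union>k.
           {(comm (Wm 0) (Wp k), free_scale (inverse (q + inverse q)) (Gt k - G k)),
            (comm (Wm k) (Wp 0), free_scale (inverse (q + inverse q)) (Gt k - G k)),
            (qc (Wm 0) (G k), free_scale \<rho> (Wm (k + 1)) - free_scale \<rho> (Wp k)),
            (qc (Gt k) (Wm 0), free_scale \<rho> (Wm (k + 1)) - free_scale \<rho> (Wp k)),
            (qc (G k) (Wp 0), free_scale \<rho> (Wp (k + 1)) - free_scale \<rho> (Wm k)),
            (qc (Wp 0) (Gt k), free_scale \<rho> (Wp (k + 1)) - free_scale \<rho> (Wm k))})
       \<union> (\<Union>k l.
           {(comm (Wm k) (Wm l), 0),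
            (comm (Wp k) (Wp l), 0),
            (comm (Wm k) (Wp l) + comm (Wp k) (Wm l), 0),
            (comm (Wm k) (G l) + comm (G k) (Wm l), 0),
            (comm (Wm k) (Gt l) + comm (Gt k) (Wm l), 0),
            (comm (Wp k) (G l) + comm (G k) (Wp l), 0),
            (comm (Wp k) (Gt l) + comm (Gt k) (Wp l), 0),
            (comm (G k) (G l), 0),
            (comm (Gt k) (Gt l), 0),
            (comm (Gt k) (G l) + comm (G k) (Gt l), 0)}))"

section \<open>Generating functions\<close>

definition Wminus_series :: "(alt_gen \<Rightarrow> 'a::ring_1) \<Rightarrow> 'a fps" where
  "Wminus_series g = Abs_fps (\<lambda>n. g (CW (- int n)))"

definition Wplus_series :: "(alt_gen \<Rightarrow> 'a::ring_1) \<Rightarrow> 'a fps" where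
  "Wplus_series g = Abs_fps (\<lambda>n. g (CW (int n + 1)))"

definition Gt_series ::
    "('f::field \<Rightarrow> 'a::ring_1 \<Rightarrow> 'a) \<Rightarrow> 'f \<Rightarrow> (alt_gen \<Rightarrow> 'a) \<Rightarrow> 'a fps" where
  "Gt_series scale q g =
     Abs_fps (\<lambda>n. case n of 0 \<Rightarrow> scale (- (q - inverse q) * (qint q 2)\<^sup>2) 1 | Suc k \<Rightarrow> g (CGt k))"

definition fps_scalar :: "('f::field \<Rightarrow> 'a::ring_1 \<Rightarrow> 'a) \<Rightarrow> 'f \<Rightarrow> 'a fps" where
  "fps_scalar scale c = fps_const (scale c 1)"

text \<open>$(q + q^{-1})/(t + t^{-1}) = (q + q^{-1}) \sum_{l} (-1)^l t^{2l+1}$\<close>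

definition subst_arg :: "('f::field \<Rightarrow> 'a::ring_1 \<Rightarrow> 'a) \<Rightarrow> 'f \<Rightarrow> 'a fps" where
  "subst_arg scale q =
     fps_scalar scale (q + inverse q) * Abs_fps (\<lambda>n. if odd n then (-1) ^ (n div 2) else 0)"

text \<open>$(t - t^{-1})^{-1} = - \sum_{l} t^{2l+1}$\<close>

definition inv_t_minus_tinv :: "'a::ring_1 fps" where
  "inv_t_minus_tinv = Abs_fps (\<lambda>n. if odd n then -1 else 0)"

end

(* Let D = [B_delta, -], applied coefficientwise to series. The defining relations say that D kills
   Gt(t) and that t D(W^-(t)), t D(W^+(t)) are explicit combinations of W^-, W^+, Gt W_0 and Gt W_1,
   while the recurrences for B_{n delta + alpha_i} express (1 - u^2) B(u) through W_0, W_1 and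
   u D(B(u)). Put s = (q + 1/q)/(t + 1/t). Both Gt(s) B^-(t/q) and K (W^-(s) - q t W^+(s)), with
   K = -(q^2 - q^-2)(q + 1/q)/(1 + t^2), satisfy one equation X = u^2 X + ... + c u D(X), which has a
   single solution in power series; likewise for Gt(s) B^+(q t) and K (W^+(s) - t/q W^-(s)). Solving
   these two linear equations for W^-(s) and W^+(s) gives the theorem. *)

theory Submission
  imports Defs
begin

section \<open>Evaluation of free algebras and presentations\<close>

unbundle fps_syntax

context unital_algebra
begin

text \<open>Words outside the support contribute zero. A larger index set lets two elements be
  summed over the same words, as additivity requires.\<close>

lemma free_eval_eq_sum:
  assumes "finite S" "Poly_Mapping.keys p \<subseteq> S"
  shows "free_eval scale g p =
    (\<Sum>w\<in>S. scale (Poly_Mapping.lookup p w) (prod_list (map g (letters w))))"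
  unfolding free_eval_def using assms
  by (intro sum.mono_neutral_left) (auto simp: in_keys_iff)

lemma free_eval_single:
  "free_eval scale g (Poly_Mapping.single w c) = scale c (prod_list (map g (letters w)))"
  by (subst free_eval_eq_sum[where S = "{w}"]) (auto simp: lookup_single)

lemma free_eval_zero [simp]: "free_eval scale g 0 = 0"
  by (simp add: free_eval_def)

lemma free_eval_add: "free_eval scale g (p + r) = free_eval scale g p + free_eval scale g r"
proof -
  let ?S = "Poly_Mapping.keys p \<union> Poly_Mapping.keys r"
  have "Poly_Mapping.keys (p + r) \<subseteq> ?S"
    by (rule Poly_Mapping.keys_add)
  then show ?thesis
    by (simp add: free_eval_eq_sum[where S = ?S] lookup_add scale_left_distrib sum.distrib)
qed

lemma free_eval_diff: "free_eval scale g (p - r) = free_eval scale g p - free_eval scale g r"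
  by (metis add_diff_cancel_right' diff_add_cancel free_eval_add)

lemma free_eval_sum: "free_eval scale g (sum p I) = (\<Sum>i\<in>I. free_eval scale g (p i))"
  by (induction I rule: infinite_finite_induct) (auto simp: free_eval_add)

lemma sum_single_lookup:
  "(\<Sum>w\<in>Poly_Mapping.keys p. Poly_Mapping.single w (Poly_Mapping.lookup p w)) = p"
proof (rule poly_mapping_eqI)
  fix w
  show "Poly_Mapping.lookup (\<Sum>w\<in>Poly_Mapping.keys p. Poly_Mapping.single w (Poly_Mapping.lookup p w)) w
      = Poly_Mapping.lookup p w"
    by (auto simp: lookup_sum lookup_single when_def in_keys_iff)
qed

text \<open>Both factors are expanded into monomials; a concatenation of words evaluates to the
  product, and scalars move out of products.\<close>

lemma free_eval_mult: "free_eval scale g (p * r) = free_eval scale g p * free_eval scale g r"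
proof -
  let ?P = "\<lambda>w. Poly_Mapping.single w (Poly_Mapping.lookup p w)"
  let ?R = "\<lambda>w. Poly_Mapping.single w (Poly_Mapping.lookup r w)"
  have "p * r = (\<Sum>v\<in>Poly_Mapping.keys p. ?P v) * (\<Sum>w\<in>Poly_Mapping.keys r. ?R w)"
    by (simp add: sum_single_lookup)
  also have "\<dots> = (\<Sum>v\<in>Poly_Mapping.keys p. \<Sum>w\<in>Poly_Mapping.keys r.
      Poly_Mapping.single (v + w) (Poly_Mapping.lookup p v * Poly_Mapping.lookup r w))"
    by (simp add: sum_product mult_single)
  finally show ?thesis
    unfolding free_eval_def[of _ _ p] free_eval_def[of _ _ r]
    by (simp add: free_eval_sum free_eval_single sum_product plus_free_word_def
        scale_mult_left scale_mult_right mult.commute)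
qed

lemma free_eval_gen: "free_eval scale g (free_gen x) = g x"
  by (simp add: free_gen_def free_eval_single)

lemma free_eval_scale: "free_eval scale g (free_scale c p) = scale c (free_eval scale g p)"
  by (simp add: free_scale_def free_eval_mult free_eval_single zero_free_word_def scale_mult_left)

lemmas free_eval_simps = free_eval_add free_eval_diff free_eval_mult free_eval_gen free_eval_scale

end

text \<open>\<open>l - r\<close> lies in the generated ideal, which is the kernel of
  evaluation.\<close>

lemma presented_algebra_relation:
  assumes "presented_algebra scale g R" "(l, r) \<in> R"
  shows "free_eval scale g l = free_eval scale g r"
proof -
  interpret unital_algebra scale
    using assms(1) by (simp add: presented_algebra_def)
  have "l - r \<in> two_sided_ideal hull ((\<lambda>(l, r). l - r) ` R)"
    using assms(2) by (intro hull_inc) force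
  then have "free_eval scale g (l - r) = 0"
    using assms(1) unfolding presented_algebra_def by blast
  then show ?thesis
    by (simp add: free_eval_diff)
qed

text \<open>A homomorphism preserves the recursion. Hence the images of the root vectors can be
  computed in the target algebra, from the images of W_0 and W_1 alone.\<close>

lemma algebra_hom_B_alpha:
  assumes "algebra_hom sA sB f"
  shows "f (B_alpha0 sA q g n) = B_alpha0 sB q (\<lambda>x. f (g x)) n"
    and "f (B_alpha1 sA q g n) = B_alpha1 sB q (\<lambda>x. f (g x)) n"
proof -
  interpret Vector_Spaces.linear sA sB f
    using assms by (simp add: algebra_hom_def)
  have m: "f (x * y) = f x * f y" for x y
    using assms by (simp add: algebra_hom_def)
  note hom = add diff scale m comm_def
  have d: "f (B_delta sA q g) = B_delta sB q (\<lambda>x. f (g x))"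
    by (simp add: B_delta_def hom)
  show "f (B_alpha0 sA q g n) = B_alpha0 sB q (\<lambda>x. f (g x)) n"
    by (induction n rule: B_alpha0.induct) (simp_all add: hom d)
  show "f (B_alpha1 sA q g n) = B_alpha1 sB q (\<lambda>x. f (g x)) n"
    by (induction n rule: B_alpha1.induct) (simp_all add: hom d)
qed

section \<open>Power series with scalar coefficients\<close>

context unital_algebra
begin

text \<open>Maps the commutative series ring into the centre of the noncommutative one, so that
  identities between coefficients can be settled in \<open>'f fps\<close>.\<close>

definition scalar_fps :: "'f fps \<Rightarrow> 'a fps" where
  "scalar_fps p = Abs_fps (\<lambda>n. scale (p $ n) 1)"

lemma scalar_fps_nth [simp]: "scalar_fps p $ n = scale (p $ n) 1"
  by (simp add: scalar_fps_def)

lemma scalar_fps_one [simp]: "scalar_fps 1 = 1"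
  and scalar_fps_X [simp]: "scalar_fps fps_X = fps_X"
  and scalar_fps_diff: "scalar_fps (p - r) = scalar_fps p - scalar_fps r"
  and scalar_fps_minus: "scalar_fps (- p) = - scalar_fps p"
  and scalar_fps_const: "scalar_fps (fps_const c) = fps_const (scale c 1)"
  by (auto simp: fps_eq_iff fps_X_def scale_left_distrib scale_left_diff_distrib)

lemma scalar_fps_mult: "scalar_fps (p * r) = scalar_fps p * scalar_fps r"
  by (simp add: fps_eq_iff fps_mult_nth scale_sum_left scale_mult_left mult.commute)

lemma scalar_fps_mult_nth:
  "(scalar_fps p * F) $ n = (\<Sum>i=0..n. scale (p $ i) (F $ (n - i)))"
  by (simp add: fps_mult_nth scale_mult_left)

lemma scalar_fps_central: "F * scalar_fps p = scalar_fps p * F"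
proof (rule fps_ext)
  fix n
  have "(F * scalar_fps p) $ n = (\<Sum>i=0..n. scale (p $ (n - i)) (F $ i))"
    by (simp add: fps_mult_nth scale_mult_right)
  also have "\<dots> = (scalar_fps p * F) $ n"
    unfolding scalar_fps_mult_nth by (rule sum.reindex_bij_witness[of _ "(-) n" "(-) n"]) auto
  finally show "(F * scalar_fps p) $ n = (scalar_fps p * F) $ n" .
qed

lemma mult_scalar_fps_left: "F * (scalar_fps p * H) = scalar_fps p * (F * H)"
  by (metis mult.assoc scalar_fps_central)

lemma comm_scalar_fps_left: "comm F (scalar_fps p * H) = scalar_fps p * comm F H"
  by (simp add: comm_def mult_scalar_fps_left right_diff_distrib mult.assoc)

lemma scalar_fps_power: "scalar_fps p ^ n = scalar_fps (p ^ n)"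
  by (induction n) (simp_all add: scalar_fps_mult)

text \<open>\<open>p ^ i\<close> has no terms below degree i, so the summands with i > n vanish. A
  bound \<open>N\<close> independent of n lets several coefficients share one range.\<close>

lemma compose_scalar_fps_nth:
  assumes "p $ 0 = 0" "n \<le> N"
  shows "(F oo scalar_fps p) $ n = (\<Sum>i=0..N. scale (p ^ i $ n) (F $ i))"
proof -
  have "(F oo scalar_fps p) $ n = (\<Sum>i=0..n. scale (p ^ i $ n) (F $ i))"
    by (simp add: fps_compose_nth scalar_fps_power scale_mult_right)
  also have "\<dots> = (\<Sum>i=0..N. scale (p ^ i $ n) (F $ i))"
    using assms by (intro sum.mono_neutral_left) (auto simp: startsby_zero_power_prefix)
  finally show ?thesis .
qed

lemma compose_scalar_fps_add:
    "(F + H) oo scalar_fps p = (F oo scalar_fps p) + (H oo scalar_fps p)"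
  and compose_scalar_fps_diff:
    "(F - H) oo scalar_fps p = (F oo scalar_fps p) - (H oo scalar_fps p)"
  and compose_scalar_fps_const_mult:
    "(fps_const x * F) oo scalar_fps p = fps_const x * (F oo scalar_fps p)"
  by (simp_all add: fps_eq_iff fps_compose_nth algebra_simps sum.distrib sum_subtractf sum_distrib_left)

text \<open>In \<open>fps_compose\<close> the coefficients of \<open>F\<close> stand to the left of
  the powers of the inner series; \<open>x\<close> moves past these powers because they are
  scalar.\<close>

lemma compose_scalar_fps_mult_const:
  "(F * fps_const x) oo scalar_fps p = (F oo scalar_fps p) * fps_const x"
  by (simp add: fps_eq_iff fps_compose_nth scalar_fps_power scale_mult_left scale_mult_right
      sum_distrib_right)

lemma compose_scalar_fps_const: "fps_const x oo scalar_fps p = fps_const x"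
  by (auto simp: fps_eq_iff fps_compose_nth if_distrib if_distribR sum.delta cong: if_cong)

lemma compose_scalar_fps_comm_const:
  "comm (fps_const x) F oo scalar_fps p = comm (fps_const x) (F oo scalar_fps p)"
  by (simp add: comm_def compose_scalar_fps_diff compose_scalar_fps_const_mult
      compose_scalar_fps_mult_const)

text \<open>Coefficientwise this is p * p^i = p^(i+1), combined with the shift of indices that
  multiplication by t causes.\<close>

lemma compose_scalar_fps_X_mult:
  assumes "p $ 0 = 0"
  shows "(fps_X * F) oo scalar_fps p = scalar_fps p * (F oo scalar_fps p)"
proof (rule fps_ext)
  fix n
  have "(scalar_fps p * (F oo scalar_fps p)) $ n =
      (\<Sum>j=0..n. \<Sum>i=0..n. scale (p $ j * p ^ i $ (n - j)) (F $ i))"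
    using assms by (simp add: scalar_fps_mult_nth compose_scalar_fps_nth[where N = n] scale_sum_right)
  also have "\<dots> = (\<Sum>i=0..n. scale ((p ^ Suc i) $ n) (F $ i))"
    by (subst sum.swap) (simp add: fps_mult_nth scale_sum_left)
  \<comment> \<open>The shifted range has one more term, at i = 0, which vanishes because
    \<open>fps_X * F\<close> has no constant term.\<close>
  also have "\<dots> = (\<Sum>i=0..Suc n. scale (p ^ i $ n) ((fps_X * F) $ i))"
    by (subst sum.atLeast0_atMost_Suc_shift) simp
  also have "\<dots> = ((fps_X * F) oo scalar_fps p) $ n"
    using assms by (simp only: compose_scalar_fps_nth[where N = "Suc n"] le_SucI order_refl)
  finally show "((fps_X * F) oo scalar_fps p) $ n = (scalar_fps p * (F oo scalar_fps p)) $ n" ..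
qed

text \<open>The equation determines the coefficients of \<open>E\<close> successively, since \<open>u\<close> and \<open>v\<close> have
  no constant term.\<close>

lemma comm_equation_unique:
  assumes "u $ 0 = 0" "v $ 0 = 0"
    and "E = scalar_fps u * E + scalar_fps v * comm (fps_const x) E"
  shows "E = 0"
proof (rule fps_ext)
  fix n
  show "E $ n = (0 :: 'a fps) $ n"
  proof (induction n rule: less_induct)
    case (less n)
    \<comment> \<open>For i = 0 the factor from \<open>c\<close> is zero; for i > 0 the induction
      hypothesis kills coefficient n - i of \<open>E\<close>, hence also that of its bracket with a
      constant.\<close>
    have z: "scale (c $ i) (H $ (n - i)) = 0"
      if "i \<le> n" "c $ 0 = 0" "H = E \<or> H = comm (fps_const x) E" for c H i
      using that less[of "n - i"] by (cases "i = 0") (auto simp: comm_def)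
    show ?case
      by (subst assms(3)) (simp add: scalar_fps_mult_nth z assms(1,2))
  qed
qed

end

section \<open>Brackets with $B_\delta$\<close>

context unital_algebra
begin

lemmas scale_algebra_simps =
  scale_mult_left scale_mult_right scale_left_distrib scale_right_distrib
  scale_left_diff_distrib scale_right_diff_distrib distrib_left distrib_right
  left_diff_distrib right_diff_distrib mult.assoc

lemma rcomm_eq_left:
  assumes "rcomm scale q x a = z" "q \<noteq> 0"
  shows "x * a = scale (inverse q ^ 2) (a * x) + scale (inverse q) z"
  using assms by (auto simp: rcomm_def scale_right_diff_distrib power2_eq_square)

lemma rcomm_eq_right:
  assumes "rcomm scale q b x = z" "q \<noteq> 0"
  shows "x * b = scale (q ^ 2) (b * x) - scale q z"
  using assms by (auto simp: rcomm_def scale_right_diff_distrib power2_eq_square)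

text \<open>Moving \<open>x\<close> through \<open>b\<close> and \<open>a\<close> produces the
  factors q^2 and q^-2, which cancel, so only error terms in \<open>M\<close> and \<open>P\<close>
  survive. They form a multiple of \<open>comm M b - comm a P\<close>. In the application a = W_0, b
  = W_1.\<close>

lemma comm_delta_eq_zero:
  assumes "q \<noteq> 0" and "rcomm scale q x a = scale r M" and "rcomm scale q b x = scale r P"
    and "comm a P = comm M b"
  shows "comm (scale (inverse q ^ 2) (b * a) - a * b) x = 0"
proof -
  note xa = rcomm_eq_left[OF assms(2,1)] and xb = rcomm_eq_right[OF assms(3,1)]
  have u: "inverse q ^ 2 * q ^ 2 = 1"
    using assms(1) by (simp add: power_mult_distrib[symmetric])
  have xba: "x * (b * a) = b * (a * x) + scale (q * r) (b * M - P * a)"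
    unfolding mult.assoc[symmetric] xb left_diff_distrib scale_mult_left
    unfolding mult.assoc xa
    using assms(1) u by (simp add: scale_algebra_simps power2_eq_square mult.commute)
  have xab: "x * (a * b) = a * (b * x) + scale (inverse q * r) (M * b - a * P)"
    unfolding mult.assoc[symmetric] xa distrib_right scale_mult_left
    unfolding mult.assoc xb
    using assms(1) u by (simp add: scale_algebra_simps power2_eq_square mult.commute)
  have "comm (scale (inverse q ^ 2) (b * a) - a * b) x = 
     scale (inverse q * r) (M * b - a * P) - scale (inverse q ^ 2) (scale (q * r) (b * M - P * a))"
    unfolding comm_def right_diff_distrib scale_mult_right xba xab
    by (simp add: scale_algebra_simps)
  also have "inverse q ^ 2 * (q * r) = inverse q * r"
    using assms(1) by (simp add: power2_eq_square)
  then have "scale (inverse q ^ 2) (scale (q * r) (b * M - P * a)) = scale (inverse q * r) (b * M - P * a)"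
    by simp
  finally have "comm (scale (inverse q ^ 2) (b * a) - a * b) x = 
     scale (inverse q * r) (comm M b - comm a P)"
    by (simp add: comm_def scale_right_diff_distrib)
  then show ?thesis
    using assms(4) by simp
qed

text \<open>As \<open>w\<close> commutes with \<open>a\<close>, only \<open>comm w b\<close>, a
  multiple of \<open>x - y\<close>, enters. Moving \<open>a\<close> to the right of \<open>x\<close>
  and \<open>y\<close> cancels the \<open>y\<close> terms and leaves (q^2 - q^-2) x a, whose factor
  q + 1/q is absorbed by \<open>?m\<close>.\<close>

lemma comm_delta_minus:
  assumes "q \<noteq> 0" "q + inverse q \<noteq> 0" and "comm a w = 0"
    and "comm w b = scale (inverse (q + inverse q)) (x - y)"
    and "rcomm scale q x a = scale r M" and "rcomm scale q a y = scale r M"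
  shows "comm (scale (inverse q ^ 2) (b * a) - a * b) w = 
    scale (q - inverse q) (x * a) - scale r M"
proof -
  let ?m = "inverse (q + inverse q)"
  have aw: "a * w = w * a"
    using assms(3) by (simp add: comm_def)
  have "comm (scale (inverse q ^ 2) (b * a) - a * b) w =
      a * comm w b - scale (inverse q ^ 2) (comm w b * a)"
    by (simp add: comm_def scale_algebra_simps aw) (simp add: mult.assoc[symmetric] aw)
  also have "\<dots> = scale ?m (a * x - a * y - scale (inverse q ^ 2) (x * a - y * a))"
    by (simp add: assms(4) scale_algebra_simps mult.commute)
  also have "a * x = scale (q ^ 2) (x * a) - scale (q * r) M"
    using rcomm_eq_right[OF assms(5,1)] by simp
  also have "a * y = scale (inverse q ^ 2) (y * a) + scale (inverse q * r) M"
    using rcomm_eq_left[OF assms(6,1)] by simp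
  also have "scale (q ^ 2) (x * a) - scale (q * r) M
      - (scale (inverse q ^ 2) (y * a) + scale (inverse q * r) M)
      - scale (inverse q ^ 2) (x * a - y * a)
    = scale ((q + inverse q) * (q - inverse q)) (x * a) - scale ((q + inverse q) * r) M"
    by (simp add: scale_right_diff_distrib scale_left_diff_distrib scale_left_distrib algebra_simps
        power2_eq_square)
  also have "scale ?m \<dots> = scale (q - inverse q) (x * a) - scale r M"
    using assms(2) by (simp add: scale_right_diff_distrib mult.assoc[symmetric])
  finally show ?thesis .
qed

text \<open>The mirror image, with \<open>v\<close> commuting with \<open>b\<close>; here too the
  \<open>y\<close> terms cancel. The factor q^2 clears the q^-2 in front of
  \<open>b * a\<close>.\<close>

lemma comm_delta_plus:
  assumes "q \<noteq> 0" "q + inverse q \<noteq> 0" and "comm v b = 0"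
    and "comm a v = scale (inverse (q + inverse q)) (x - y)"
    and "rcomm scale q b x = scale r P" and "rcomm scale q y b = scale r P"
  shows "scale (q ^ 2) (comm (scale (inverse q ^ 2) (b * a) - a * b) v) = 
    scale r P - scale (q - inverse q) (x * b)"
proof -
  let ?m = "inverse (q + inverse q)"
  have u: "q ^ 2 * inverse q ^ 2 = 1"
    using assms(1) by (simp add: power_mult_distrib[symmetric])
  have bv: "b * v = v * b"
    using assms(3) by (simp add: comm_def)
  have "comm (scale (inverse q ^ 2) (b * a) - a * b) v =
      scale (inverse q ^ 2) (b * comm a v) - comm a v * b"
    by (simp add: comm_def scale_algebra_simps bv) (simp add: mult.assoc[symmetric] bv)
  also have "scale (q ^ 2) \<dots> = b * comm a v - scale (q ^ 2) (comm a v * b)"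
    using u by (simp add: scale_right_diff_distrib)
  also have "\<dots> = scale ?m (b * x - b * y - scale (q ^ 2) (x * b - y * b))"
    by (simp add: assms(4) scale_algebra_simps mult.commute)
  also have "b * x = scale (inverse q ^ 2) (x * b) + scale (inverse q * r) P"
    using rcomm_eq_left[OF assms(5,1)] by simp
  also have "b * y = scale (q ^ 2) (y * b) - scale (q * r) P"
    using rcomm_eq_right[OF assms(6,1)] by simp
  also have "scale (inverse q ^ 2) (x * b) + scale (inverse q * r) P
      - (scale (q ^ 2) (y * b) - scale (q * r) P)
      - scale (q ^ 2) (x * b - y * b)
    = scale ((q + inverse q) * r) P - scale ((q + inverse q) * (q - inverse q)) (x * b)"
    by (simp add: scale_right_diff_distrib scale_left_diff_distrib scale_left_distrib algebra_simps
        power2_eq_square)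
  also have "scale ?m \<dots> = scale r P - scale (q - inverse q) (x * b)"
    using assms(2) by (simp add: scale_right_diff_distrib mult.assoc[symmetric])
  finally show ?thesis .
qed

text \<open>Applied twice: with \<open>x\<close> equal to $B_\delta$, and with $x = -q^2 B_\delta$, which exchanges the roles
  of \<open>Q\<close> and \<open>P\<close>, of \<open>M\<close> and \<open>N\<close>, and of \<open>A\<close> and \<open>A'\<close>.\<close>

lemma comm_equation_solution:
  fixes x :: 'a and P Q K k e d \<sigma> :: "'f fps"
  defines "C \<equiv> comm (fps_const x)"
  assumes M: "scalar_fps (e * \<sigma>) * C M = A - scalar_fps k * M + scalar_fps (k * \<sigma>) * N"
    and N: "scalar_fps (Q\<^sup>2 * e * \<sigma>) * C N = scalar_fps k * N - scalar_fps (k * \<sigma>) * M - A'"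
    and L: "L = scalar_fps ((P * fps_X)\<^sup>2) * L + A + scalar_fps (P * fps_X) * A' + scalar_fps d * C L"
    and QP: "Q * P = 1" and \<sigma>: "\<sigma> * (1 + fps_X\<^sup>2) = (Q + P) * fps_X"
    and K: "K * (1 + fps_X\<^sup>2) = k" and d0: "d $ 0 = 0" and dK: "d * K = - (e * \<sigma>)"
  shows "L = scalar_fps K * M - scalar_fps (K * Q * fps_X) * N"
proof -
  define R where "R = scalar_fps K * M - scalar_fps (K * Q * fps_X) * N"
  have C_diff: "C (F - H) = C F - C H" for F H
    by (simp add: C_def comm_def algebra_simps)
  have "scalar_fps d * C R = scalar_fps (d * K) * C M - scalar_fps (d * K * Q * fps_X) * C N"
    unfolding R_def C_diff
    by (simp only: C_def comm_scalar_fps_left right_diff_distrib mult.assoc[symmetric]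
        scalar_fps_mult[symmetric])
  \<comment> \<open>Q P = 1 trades Q t for P t times Q^2, the form to which \<open>N\<close>
    applies.\<close>
  also have "d * K * Q * fps_X = - (P * fps_X) * (Q\<^sup>2 * e * \<sigma>)"
    unfolding dK using QP by algebra
  also have "scalar_fps (d * K) * C M - scalar_fps (- (P * fps_X) * (Q\<^sup>2 * e * \<sigma>)) * C N =
      scalar_fps (P * fps_X) * (scalar_fps (Q\<^sup>2 * e * \<sigma>) * C N) - scalar_fps (e * \<sigma>) * C M"
    unfolding dK by (simp only: scalar_fps_minus scalar_fps_mult mult.assoc) (simp add: mult.assoc)
  also have "\<dots> = scalar_fps (P * fps_X) * (scalar_fps k * N - scalar_fps (k * \<sigma>) * M - A')
      - (A - scalar_fps k * M + scalar_fps (k * \<sigma>) * N)"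
    unfolding M N ..
  also have "\<dots> = scalar_fps (k - P * fps_X * (k * \<sigma>)) * M - scalar_fps (k * \<sigma> - P * fps_X * k) * N
      - A - scalar_fps (P * fps_X) * A'"
    by (simp only: scalar_fps_diff scalar_fps_mult) (simp add: algebra_simps)
  \<comment> \<open>Both coefficients acquire the factor 1 - (P t)^2, so the terms in
    \<open>M\<close> and \<open>N\<close> together become R - (P t)^2 R.\<close>
  also have "k - P * fps_X * (k * \<sigma>) = K - (P * fps_X)\<^sup>2 * K"
    using QP \<sigma> K by algebra
  also have "k * \<sigma> - P * fps_X * k = (1 - (P * fps_X)\<^sup>2) * (K * Q * fps_X)"
    using QP \<sigma> K by algebra
  finally have R: "R = scalar_fps ((P * fps_X)\<^sup>2) * R + A + scalar_fps (P * fps_X) * A' + scalar_fps d * C R"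
    unfolding R_def by (simp only: scalar_fps_diff scalar_fps_mult scalar_fps_one) (simp add: algebra_simps)
  \<comment> \<open>The inhomogeneous terms cancel in the difference, and the homogeneous equation
    has only the zero solution.\<close>
  have "L - R = (scalar_fps ((P * fps_X)\<^sup>2) * L + A + scalar_fps (P * fps_X) * A' + scalar_fps d * C L)
      - (scalar_fps ((P * fps_X)\<^sup>2) * R + A + scalar_fps (P * fps_X) * A' + scalar_fps d * C R)"
    by (rule arg_cong2[where f = minus, OF L R])
  also have "\<dots> = scalar_fps ((P * fps_X)\<^sup>2) * (L - R) + scalar_fps d * C (L - R)"
    by (simp add: C_diff right_diff_distrib)
  finally have "L - R = 0"
    unfolding C_def by (rule comm_equation_unique[rotated 2]) (simp_all add: d0 power2_eq_square)
  then show ?thesis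
    by (simp add: R_def)
qed

end

section \<open>Generating functions of the root vectors and of the alternating generators\<close>

lemma comm_diff_left: "comm (x - y) z = comm x z - comm y z"
  and comm_diff_right: "comm x (y - z) = comm x y - comm x z"
  by (simp_all add: comm_def algebra_simps)

context unital_algebra
begin

text \<open>The two-step recursion gives the factor t^2; the two initial values supply the terms W_0
  and t W_1.\<close>

lemma B_alpha0_series:
  "Abs_fps (B_alpha0 scale q h) = fps_X * (fps_X * Abs_fps (B_alpha0 scale q h)) +
     fps_const (h W0) + fps_X * fps_const (h W1) +
     fps_X * (fps_const (scale (B_const q) 1) *
       comm (fps_const (B_delta scale q h)) (Abs_fps (B_alpha0 scale q h)))"
  (is "?F = ?G")
proof (rule fps_ext)
  fix n
  show "?F $ n = ?G $ n"
    by (induction n rule: B_alpha0.induct)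
      (simp_all add: comm_def scale_mult_left scale_right_diff_distrib algebra_simps)
qed

lemma B_alpha1_series:
  "Abs_fps (B_alpha1 scale q h) = fps_X * (fps_X * Abs_fps (B_alpha1 scale q h)) +
     fps_const (h W1) + fps_X * fps_const (h W0) -
     fps_X * (fps_const (scale (B_const q) 1) *
       comm (fps_const (B_delta scale q h)) (Abs_fps (B_alpha1 scale q h)))"
  (is "?F = ?G")
proof (rule fps_ext)
  fix n
  show "?F $ n = ?G $ n"
    by (induction n rule: B_alpha1.induct)
      (simp_all add: comm_def scale_mult_left scale_right_diff_distrib algebra_simps)
qed

lemma compose_scalar_fps_X:
  assumes "p $ 0 = 0"
  shows "fps_X oo scalar_fps p = scalar_fps p"
  using compose_scalar_fps_X_mult[OF assms, of 1] compose_scalar_fps_const[of 1 p] by simp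

lemma scalar_fps_power2: "scalar_fps (p\<^sup>2) = scalar_fps p * scalar_fps p"
  by (simp add: power2_eq_square scalar_fps_mult)

lemmas compose_scalar_fps_simps = compose_scalar_fps_add compose_scalar_fps_diff
  compose_scalar_fps_X_mult compose_scalar_fps_X compose_scalar_fps_const_mult compose_scalar_fps_mult_const
  compose_scalar_fps_const compose_scalar_fps_comm_const

lemma B_alpha0_series_compose:
  fixes p :: "'f fps" and q :: 'f and h :: "onsager_gen \<Rightarrow> 'a"
  assumes "p $ 0 = 0"
  defines "F \<equiv> Abs_fps (B_alpha0 scale q h) oo scalar_fps p"
  shows "F = scalar_fps (p\<^sup>2) * F + fps_const (h W0) + scalar_fps p * fps_const (h W1) +
    scalar_fps (p * fps_const (B_const q)) * comm (fps_const (B_delta scale q h)) F"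
  unfolding F_def
  by (subst B_alpha0_series)
    (simp only: compose_scalar_fps_simps assms(1) scalar_fps_power2 scalar_fps_mult
      scalar_fps_const mult.assoc)

lemma B_alpha1_series_compose:
  fixes p :: "'f fps" and q :: 'f and h :: "onsager_gen \<Rightarrow> 'a"
  assumes "p $ 0 = 0"
  defines "F \<equiv> Abs_fps (B_alpha1 scale q h) oo scalar_fps p"
  shows "F = scalar_fps (p\<^sup>2) * F + fps_const (h W1) + scalar_fps p * fps_const (h W0) -
    scalar_fps (p * fps_const (B_const q)) * comm (fps_const (B_delta scale q h)) F"
  unfolding F_def
  by (subst B_alpha1_series)
    (simp only: compose_scalar_fps_simps assms(1) scalar_fps_power2 scalar_fps_mult
      scalar_fps_const mult.assoc)

text \<open>The bracket with \<open>x\<close> is a derivation, so the term in which it hits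
  \<open>F\<close> drops out. This carries the bracket with B_delta past Gt(s).\<close>

lemma comm_mult_left_commuting:
  assumes "comm x F = 0"
  shows "comm x (F * H) = F * comm x H"
proof -
  have "x * F = F * x"
    using assms by (simp add: comm_def)
  then show ?thesis
    by (simp add: comm_def right_diff_distrib flip: mult.assoc)
qed

end

section \<open>Brackets of B_delta with the alternating generators\<close>

locale alternating_relations = unital_algebra scale
  for scale :: "'f::field \<Rightarrow> 'a::ring_1 \<Rightarrow> 'a" +
  fixes q :: 'f and g :: "alt_gen \<Rightarrow> 'a" and \<rho> :: 'f
  defines "\<rho> \<equiv> - ((q\<^sup>2 - inverse q ^ 2)\<^sup>2)"
  assumes q_nonzero: "q \<noteq> 0" and q_power4: "q ^ 4 \<noteq> 1"
    and comm_W0_Wplus: "comm (g (CW 0)) (g (CW (int k + 1))) =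
          scale (inverse (q + inverse q)) (g (CGt k) - g (CG k))"
    and comm_Wminus_W1: "comm (g (CW (- int k))) (g (CW 1)) =
          scale (inverse (q + inverse q)) (g (CGt k) - g (CG k))"
    and rcomm_W0_G: "rcomm scale q (g (CW 0)) (g (CG k)) =
          scale \<rho> (g (CW (- int (Suc k))) - g (CW (int k + 1)))"
    and rcomm_Gt_W0: "rcomm scale q (g (CGt k)) (g (CW 0)) =
          scale \<rho> (g (CW (- int (Suc k))) - g (CW (int k + 1)))"
    and rcomm_G_W1: "rcomm scale q (g (CG k)) (g (CW 1)) =
          scale \<rho> (g (CW (int k + 2)) - g (CW (- int k)))"
    and rcomm_W1_Gt: "rcomm scale q (g (CW 1)) (g (CGt k)) =
          scale \<rho> (g (CW (int k + 2)) - g (CW (- int k)))"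
    and comm_W0_Wminus: "comm (g (CW 0)) (g (CW (- int k))) = 0"
    and comm_Wplus_W1: "comm (g (CW (int k + 1))) (g (CW 1)) = 0"
begin

abbreviation p :: 'f where "p \<equiv> inverse q"

abbreviation "Wm \<equiv> Wminus_series g"
abbreviation "Wp \<equiv> Wplus_series g"
abbreviation "Gt \<equiv> Gt_series scale q g"

definition delta :: 'a where
  "delta = scale (p ^ 2) (g (CW 1) * g (CW 0)) - g (CW 0) * g (CW 1)"

text \<open>q + 1/q = 0 would give q^2 = -1, and q - 1/q = 0 would give q^2 = 1; both are excluded
  by q^4 \<noteq> 1.\<close>

lemma q_plus_inverse_nonzero: "q + p \<noteq> 0"
proof
  assume "q + p = 0"
  then have "q * q = - 1"
    using q_nonzero by (simp add: field_simps eq_neg_iff_add_eq_0)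
  then have "(q * q) * (q * q) = 1"
    by simp
  then show False
    using q_power4 by (simp add: eval_nat_numeral mult.assoc)
qed

lemma q_minus_inverse_nonzero: "q - p \<noteq> 0"
proof
  assume "q - p = 0"
  then have "q * q = 1"
    using q_nonzero by (simp add: field_simps)
  then have "(q * q) * (q * q) = 1"
    by simp
  then show False
    using q_power4 by (simp add: eval_nat_numeral mult.assoc)
qed

lemma comm_delta_Gt: "comm delta (g (CGt k)) = 0"
  unfolding delta_def
proof (rule comm_delta_eq_zero[OF q_nonzero rcomm_Gt_W0 rcomm_W1_Gt])
  \<comment> \<open>The terms [W_0, W_{-k}] and [W_{k+1}, W_1] vanish. What remains is
    [W_0, W_{k+2}] and [W_{-k-1}, W_1], both the same multiple of Gt_{k+2} - G_{k+2}.\<close>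
  show "comm (g (CW 0)) (g (CW (int k + 2)) - g (CW (- int k))) =
      comm (g (CW (- int (Suc k))) - g (CW (int k + 1))) (g (CW 1))"
    using comm_W0_Wplus[of "Suc k"] comm_Wminus_W1[of "Suc k"] comm_W0_Wminus[of k] comm_Wplus_W1[of k]
    by (simp add: comm_diff_left comm_diff_right add.commute)
qed

lemma comm_delta_Wminus:
  "comm delta (g (CW (- int k))) = scale (q - p) (g (CGt k) * g (CW 0)) -
    scale \<rho> (g (CW (- int (Suc k))) - g (CW (int k + 1)))"
  unfolding delta_def
  by (rule comm_delta_minus[OF q_nonzero q_plus_inverse_nonzero comm_W0_Wminus comm_Wminus_W1
        rcomm_Gt_W0 rcomm_W0_G])

lemma comm_delta_Wplus:
  "scale (q ^ 2) (comm delta (g (CW (int k + 1)))) =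
    scale \<rho> (g (CW (int k + 2)) - g (CW (- int k))) - scale (q - p) (g (CGt k) * g (CW 1))"
  unfolding delta_def
  by (rule comm_delta_plus[OF q_nonzero q_plus_inverse_nonzero comm_Wplus_W1 comm_W0_Wplus
        rcomm_W1_Gt rcomm_G_W1])

text \<open>The normalisation of Gt_0 gives (q - 1/q) Gt_0 = \<rho>. This is the degree 0 case of
  the two series identities for W^- and W^+, whose left sides carry a factor t.\<close>

lemma Gt_series_nth_0: "scale (q - p) (Gt $ 0 * x) = scale \<rho> x"
proof -
  have "qint q 2 = q + p"
    using q_minus_inverse_nonzero by (simp add: qint_def field_simps power2_eq_square)
  then have "(q - p) * (- (q - p) * (qint q 2)\<^sup>2) = \<rho>"
    unfolding \<rho>_def by (simp add: power2_eq_square algebra_simps)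
  then show ?thesis
    by (simp add: Gt_series_def scale_mult_left del: mult_minus_left)
qed

lemma comm_delta_Gt_series: "comm (fps_const delta) Gt = 0"
proof (rule fps_ext)
  fix n
  show "comm (fps_const delta) Gt $ n = 0 $ n"
    using comm_delta_Gt
    by (cases n) (simp_all add: comm_def Gt_series_def scale_mult_left scale_mult_right)
qed

lemma comm_delta_Wminus_series:
  "fps_X * comm (fps_const delta) Wm =
    fps_const (scale (q - p) 1) * (Gt * fps_const (g (CW 0))) -
    fps_const (scale \<rho> 1) * Wm + fps_const (scale \<rho> 1) * (fps_X * Wp)"
  (is "?F = ?G")
proof (rule fps_ext)
  fix n
  show "?F $ n = ?G $ n"
  proof (cases n)
    case 0
    then show ?thesis
      by (simp add: scale_mult_left Gt_series_nth_0 Wminus_series_def)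
  next
    case (Suc k)
    have "?F $ n = comm delta (g (CW (- int k)))"
      by (simp add: Suc comm_def Wminus_series_def)
    also have "\<dots> = ?G $ n"
      unfolding comm_delta_Wminus
      by (simp add: Suc Wminus_series_def Wplus_series_def Gt_series_def scale_mult_left
          scale_right_diff_distrib algebra_simps)
    finally show ?thesis .
  qed
qed

lemma comm_delta_Wplus_series:
  "fps_const (scale (q ^ 2) 1) * (fps_X * comm (fps_const delta) Wp) =
    fps_const (scale \<rho> 1) * Wp - fps_const (scale \<rho> 1) * (fps_X * Wm) -
    fps_const (scale (q - p) 1) * (Gt * fps_const (g (CW 1)))"
  (is "?F = ?G")
proof (rule fps_ext)
  fix n
  show "?F $ n = ?G $ n"
  proof (cases n)
    case 0
    then show ?thesis
      by (simp add: scale_mult_left Gt_series_nth_0 Wplus_series_def)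
  next
    case (Suc k)
    have "?F $ n = scale (q ^ 2) (comm delta (g (CW (int k + 1))))"
      by (simp add: Suc comm_def Wplus_series_def scale_mult_left)
    also have "\<dots> = ?G $ n"
      unfolding comm_delta_Wplus
      by (simp add: Suc Wminus_series_def Wplus_series_def Gt_series_def scale_mult_left
          scale_right_diff_distrib algebra_simps)
    finally show ?thesis .
  qed
qed

end

section \<open>The substituted scalar series and the equations that determine them\<close>

context unital_algebra
begin

lemma subst_arg_eq_scalar_fps:
  obtains \<sigma> where "subst_arg scale q = scalar_fps \<sigma>" "\<sigma> $ 0 = 0"
    "\<sigma> * (1 + fps_X\<^sup>2) = fps_const (q + inverse q) * fps_X"
proof
  let ?S = "Abs_fps (\<lambda>n. if odd n then (- 1) ^ (n div 2) else 0) :: 'f fps"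
  have sgn: "scale ((- 1) ^ m) 1 = (- 1) ^ m" for m
    by (induction m) simp_all
  show "subst_arg scale q = scalar_fps (fps_const (q + inverse q) * ?S)"
    by (simp add: fps_eq_iff subst_arg_def fps_scalar_def scale_mult_left sgn flip: scale_scale)
  show "(fps_const (q + inverse q) * ?S) $ 0 = 0"
    by simp
  \<comment> \<open>Multiplication by 1 + t^2 adds coefficients two degrees apart, which alternate
    in sign; only t survives.\<close>
  have "?S * (1 + fps_X\<^sup>2) = fps_X"
  proof (rule fps_ext)
    fix n
    have "n = 0 \<or> n = 1 \<or> (\<exists>m. n = Suc (Suc m))"
      by (metis One_nat_def not0_implies_Suc)
    then show "(?S * (1 + fps_X\<^sup>2)) $ n = fps_X $ n"
      by (auto simp: distrib_left fps_X_power_mult_right_nth fps_X_nth)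
  qed
  then show "fps_const (q + inverse q) * ?S * (1 + fps_X\<^sup>2) = fps_const (q + inverse q) * fps_X"
    by (simp add: mult.assoc)
qed

lemma inv_t_minus_tinv_eq_scalar_fps:
  obtains \<tau> where "inv_t_minus_tinv = scalar_fps \<tau>" "\<tau> * (1 - fps_X\<^sup>2) = - fps_X"
proof
  let ?S = "Abs_fps (\<lambda>n. if odd n then - 1 else 0) :: 'f fps"
  show "inv_t_minus_tinv = scalar_fps ?S"
    by (simp add: fps_eq_iff inv_t_minus_tinv_def)
  show "?S * (1 - fps_X\<^sup>2) = - fps_X"
  proof (rule fps_ext)
    fix n
    have "n = 0 \<or> n = 1 \<or> (\<exists>m. n = Suc (Suc m))"
      by (metis One_nat_def not0_implies_Suc)
    then show "(?S * (1 - fps_X\<^sup>2)) $ n = (- fps_X) $ n"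
      by (auto simp: right_diff_distrib fps_X_power_mult_right_nth fps_X_nth)
  qed
qed

end

section \<open>Solving for W^-(s) and W^+(s)\<close>

context alternating_relations
begin

lemma rho_eq: "\<rho> = - ((q - p) * (q + p) * (q\<^sup>2 - p\<^sup>2))"
  unfolding \<rho>_def by (simp add: power2_eq_square algebra_simps)

lemma Gt_B_alpha_series:
  fixes \<sigma> :: "'f fps"
  assumes h: "h W0 = g (CW 0)" "h W1 = g (CW 1)"
    and \<sigma>0: "\<sigma> $ 0 = 0" and \<sigma>: "\<sigma> * (1 + fps_X\<^sup>2) = fps_const (q + p) * fps_X"
  defines "K \<equiv> fps_const (\<rho> / (q - p)) * inverse (1 + fps_X\<^sup>2)"
    and "P \<equiv> fps_const p" and "Q \<equiv> fps_const q"
    and "M \<equiv> Wm oo scalar_fps \<sigma>" and "N \<equiv> Wp oo scalar_fps \<sigma>" and "\<Gamma> \<equiv> Gt oo scalar_fps \<sigma>"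
  shows "\<Gamma> * (Abs_fps (B_alpha0 scale q h) oo scalar_fps (P * fps_X)) =
      scalar_fps K * M - scalar_fps (K * Q * fps_X) * N"
    and "\<Gamma> * (Abs_fps (B_alpha1 scale q h) oo scalar_fps (Q * fps_X)) =
      scalar_fps K * N - scalar_fps (K * P * fps_X) * M"
proof -
  define k where "k = \<rho> / (q - p)"
  \<comment> \<open>Multiplying the bracket identities by \<open>e\<close> gives \<open>A0\<close>
    and \<open>A1\<close> coefficient one up to sign and turns \<rho> into \<open>k\<close>, the
    numerator of \<open>K\<close>.\<close>
  define e where "e = inverse (q - p)"
  define A0 where "A0 = \<Gamma> * fps_const (g (CW 0))"
  define A1 where "A1 = \<Gamma> * fps_const (g (CW 1))"
  define C where "C = comm (fps_const delta)"
  \<comment> \<open>This is c u with u = t/q, the factor of the bracket in the first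
    recurrence.\<close>
  define d where "d = fps_const (B_const q) * P * fps_X"
  have delta: "B_delta scale q h = delta"
    by (simp add: B_delta_def delta_def h power_int_minus power_inverse)
  have "e * (q - p) = 1"
    using q_minus_inverse_nonzero by (simp add: e_def)
  then have ek: "e * q - e * p = 1" "e * \<rho> = k"
    by (simp_all add: right_diff_distrib e_def k_def divide_inverse)
  have PQ: "Q * P = 1" "P * Q = 1"
    using q_nonzero by (simp_all add: P_def Q_def)
  have K: "K * (1 + fps_X\<^sup>2) = fps_const k"
    by (simp add: K_def k_def mult.assoc inverse_mult_eq_1)
  have \<sigma>': "\<sigma> * (1 + fps_X\<^sup>2) = (Q + P) * fps_X" "\<sigma> * (1 + fps_X\<^sup>2) = (P + Q) * fps_X"
    unfolding \<sigma> by (simp_all add: P_def Q_def add.commute)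
  have "1 + fps_X\<^sup>2 \<noteq> (0 :: 'f fps)"
    by (rule fps_nonzeroI[of _ 0]) simp
  \<comment> \<open>Multiplying by 1 + t^2 clears the denominators of \<open>K\<close> and \<sigma>;
    what is left is c k / q = - e (q + 1/q).\<close>
  moreover have "d * K * (1 + fps_X\<^sup>2) = - (fps_const e * \<sigma>) * (1 + fps_X\<^sup>2)"
  proof -
    have "q\<^sup>2 - p\<^sup>2 = (q - p) * (q + p)"
      by (simp add: power2_eq_square algebra_simps)
    then have "B_const q * p * k = - (e * (q + p))"
      using q_minus_inverse_nonzero q_plus_inverse_nonzero q_nonzero
      by (simp add: B_const_def k_def e_def rho_eq power_int_minus power_inverse)
        (simp add: divide_inverse mult.commute)
    then have c: "fps_const (B_const q) * P * fps_const k = - (fps_const e * fps_const (q + p))"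
      by (simp add: P_def)
    have "d * K * (1 + fps_X\<^sup>2) = fps_const (B_const q) * P * (K * (1 + fps_X\<^sup>2)) * fps_X"
      by (simp only: d_def mult_ac)
    also have "\<dots> = - (fps_const e * (\<sigma> * (1 + fps_X\<^sup>2)))"
      by (simp only: K c \<sigma>) (simp only: mult_minus_left mult.assoc)
    finally show ?thesis
      by (simp only: mult_minus_left mult.assoc)
  qed
  ultimately have dK: "d * K = - (fps_const e * \<sigma>)"
    by (metis mult_right_cancel)
  have "scalar_fps \<sigma> * C M = scalar_fps (fps_const (q - p)) * A0 - scalar_fps (fps_const \<rho>) * M
      + scalar_fps (fps_const \<rho>) * (scalar_fps \<sigma> * N)"
    using arg_cong[OF comm_delta_Wminus_series, of "\<lambda>F. F oo scalar_fps \<sigma>"]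
    by (simp only: compose_scalar_fps_simps \<sigma>0 scalar_fps_const C_def M_def N_def A0_def \<Gamma>_def)
  then have "scalar_fps (fps_const e * \<sigma>) * C M = scalar_fps (fps_const e) * \<dots>"
    by (simp only: scalar_fps_mult mult.assoc)
  then have CM: "scalar_fps (fps_const e * \<sigma>) * C M =
      A0 - scalar_fps (fps_const k) * M + scalar_fps (fps_const k * \<sigma>) * N"
    by (simp only: right_diff_distrib distrib_left fps_const_mult ek fps_const_1_eq_1 scalar_fps_one mult_1
        flip: mult.assoc scalar_fps_mult)
  have "scalar_fps (fps_const (q ^ 2)) * (scalar_fps \<sigma> * C N) = scalar_fps (fps_const \<rho>) * N
      - scalar_fps (fps_const \<rho>) * (scalar_fps \<sigma> * M) - scalar_fps (fps_const (q - p)) * A1"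
    using arg_cong[OF comm_delta_Wplus_series, of "\<lambda>F. F oo scalar_fps \<sigma>"]
    by (simp only: compose_scalar_fps_simps \<sigma>0 scalar_fps_const C_def M_def N_def A1_def \<Gamma>_def)
  then have "scalar_fps (fps_const e) * (scalar_fps (fps_const (q ^ 2)) * (scalar_fps \<sigma> * C N)) =
      scalar_fps (fps_const e) * \<dots>"
    by (rule arg_cong)
  then have CN: "scalar_fps (Q\<^sup>2 * fps_const e * \<sigma>) * C N =
      scalar_fps (fps_const k) * N - scalar_fps (fps_const k * \<sigma>) * M - A1"
    by (simp only: right_diff_distrib distrib_left fps_const_mult ek fps_const_1_eq_1 scalar_fps_one mult_1
        Q_def fps_const_power mult.commute[of e "q ^ 2"] flip: mult.assoc scalar_fps_mult)
  have "C \<Gamma> = 0"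
    using arg_cong[OF comm_delta_Gt_series, of "\<lambda>F. F oo scalar_fps \<sigma>"]
    by (simp add: compose_scalar_fps_simps C_def \<Gamma>_def)
  then have C\<Gamma>: "C (\<Gamma> * F) = \<Gamma> * C F" for F
    unfolding C_def by (rule comm_mult_left_commuting)
  have u0: "(P * fps_X) $ 0 = 0" "(Q * fps_X) $ 0 = 0"
    by simp_all
  have d0: "d $ 0 = 0"
    by (simp add: d_def)

  define F where "F = Abs_fps (B_alpha0 scale q h) oo scalar_fps (P * fps_X)"
  have "\<Gamma> * F = \<Gamma> * (scalar_fps ((P * fps_X)\<^sup>2) * F + fps_const (g (CW 0)) +
      scalar_fps (P * fps_X) * fps_const (g (CW 1)) + scalar_fps d * C F)"
    using B_alpha0_series_compose[OF u0(1), of q h]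
    by (simp add: F_def delta h C_def d_def mult_ac)
  then have L: "\<Gamma> * F = scalar_fps ((P * fps_X)\<^sup>2) * (\<Gamma> * F) + A0 + scalar_fps (P * fps_X) * A1 +
      scalar_fps d * C (\<Gamma> * F)"
    by (simp only: distrib_left mult_scalar_fps_left A0_def A1_def C\<Gamma>)
  show "\<Gamma> * F = scalar_fps K * M - scalar_fps (K * Q * fps_X) * N"
    by (rule comm_equation_solution[OF CM[unfolded C_def] CN[unfolded C_def] L[unfolded C_def]
          PQ(1) \<sigma>'(1) K d0 dK])

  define H where "H = Abs_fps (B_alpha1 scale q h) oo scalar_fps (Q * fps_X)"
  \<comment> \<open>The second recurrence has the factor - c q t = - q^2 d. Putting - q^2 into the
    bracket keeps \<open>d\<close>, so \<open>dK\<close> serves again.\<close>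
  define C' where "C' = comm (fps_const (scale (- (q\<^sup>2)) delta))"
  have "fps_const (scale (- (q\<^sup>2)) delta) = scalar_fps (- (Q\<^sup>2)) * fps_const delta"
    by (simp add: scalar_fps_const Q_def scale_mult_left scalar_fps_minus)
  then have C': "C' E = scalar_fps (- (Q\<^sup>2)) * C E" for E
    unfolding C'_def C_def comm_def by (simp add: mult_scalar_fps_left right_diff_distrib mult.assoc)
  have Q2: "fps_const e * \<sigma> * - (Q\<^sup>2) = - (Q\<^sup>2 * fps_const e * \<sigma>)"
    by (simp only: mult_minus_right mult_ac)
  have P2: "P\<^sup>2 * fps_const e * \<sigma> * - (Q\<^sup>2) = - (fps_const e * \<sigma>)"
    using PQ by algebra
  have d': "d * - (Q\<^sup>2) = - (Q * fps_X * fps_const (B_const q))"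
    unfolding d_def using PQ by algebra
  have CN': "scalar_fps (fps_const e * \<sigma>) * C' N =
      A1 - scalar_fps (fps_const k) * N + scalar_fps (fps_const k * \<sigma>) * M"
  proof -
    have "scalar_fps (fps_const e * \<sigma>) * C' N = scalar_fps (- (Q\<^sup>2 * fps_const e * \<sigma>)) * C N"
      unfolding C' mult.assoc[symmetric] scalar_fps_mult[symmetric] Q2 ..
    then show ?thesis
      using CN by (simp add: scalar_fps_minus)
  qed
  have CM': "scalar_fps (P\<^sup>2 * fps_const e * \<sigma>) * C' M =
      scalar_fps (fps_const k) * M - scalar_fps (fps_const k * \<sigma>) * N - A0"
  proof -
    have "scalar_fps (P\<^sup>2 * fps_const e * \<sigma>) * C' M = scalar_fps (- (fps_const e * \<sigma>)) * C M"
      unfolding C' mult.assoc[symmetric] scalar_fps_mult[symmetric] P2 ..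
    then show ?thesis
      using CM by (simp add: scalar_fps_minus)
  qed
  have "\<Gamma> * H = \<Gamma> * (scalar_fps ((Q * fps_X)\<^sup>2) * H + fps_const (g (CW 1)) +
      scalar_fps (Q * fps_X) * fps_const (g (CW 0)) - scalar_fps (Q * fps_X * fps_const (B_const q)) * C H)"
    using B_alpha1_series_compose[OF u0(2), of q h]
    by (simp add: H_def delta h C_def)
  also have "\<dots> = scalar_fps ((Q * fps_X)\<^sup>2) * (\<Gamma> * H) + A1 + scalar_fps (Q * fps_X) * A0 +
      scalar_fps (d * - (Q\<^sup>2)) * C (\<Gamma> * H)"
    unfolding d' by (simp only: right_diff_distrib distrib_left mult_scalar_fps_left A0_def A1_def C\<Gamma>
        scalar_fps_minus mult_minus_left) simp
  finally have L': "\<Gamma> * H = scalar_fps ((Q * fps_X)\<^sup>2) * (\<Gamma> * H) + A1 + scalar_fps (Q * fps_X) * A0 +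
      scalar_fps d * C' (\<Gamma> * H)"
    by (simp only: C' scalar_fps_mult mult.assoc)
  show "\<Gamma> * H = scalar_fps K * N - scalar_fps (K * P * fps_X) * M"
    by (rule comm_equation_solution[OF CN'[unfolded C'_def] CM'[unfolded C'_def] L'[unfolded C'_def]
          PQ(2) \<sigma>'(2) K d0 dK])
qed

lemma alternating_series_eq:
  assumes h: "h W0 = g (CW 0)" "h W1 = g (CW 1)"
  defines "Bm \<equiv> Abs_fps (B_alpha0 scale q h)" and "Bp \<equiv> Abs_fps (B_alpha1 scale q h)"
    and "s \<equiv> subst_arg scale q"
    and "qt \<equiv> fps_scalar scale q * fps_X" and "qinvt \<equiv> fps_scalar scale p * fps_X"
    and "denom_inv \<equiv> fps_scalar scale (inverse (q\<^sup>2 - p\<^sup>2)) * inv_t_minus_tinv"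
  shows "s * (Wm oo s) = (Gt oo s) * ((qt * (Bp oo qt) + (Bm oo qinvt)) * denom_inv)"
    and "s * (Wp oo s) = (Gt oo s) * (((Bp oo qt) + qinvt * (Bm oo qinvt)) * denom_inv)"
proof -
  obtain \<sigma> where \<sigma>: "s = scalar_fps \<sigma>" "\<sigma> $ 0 = 0"
      "\<sigma> * (1 + fps_X\<^sup>2) = fps_const (q + p) * fps_X"
    unfolding s_def by (rule subst_arg_eq_scalar_fps)
  obtain \<tau> where \<tau>: "inv_t_minus_tinv = scalar_fps \<tau>" "\<tau> * (1 - fps_X\<^sup>2) = - fps_X"
    by (rule inv_t_minus_tinv_eq_scalar_fps)
  define P Q where "P = fps_const p" and "Q = fps_const q"
  define K where "K = fps_const (\<rho> / (q - p)) * inverse (1 + fps_X\<^sup>2 :: 'f fps)"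
  define D where "D = fps_const (inverse (q\<^sup>2 - p\<^sup>2)) * \<tau>"
  define M N where "M = Wm oo s" and "N = Wp oo s"
  have QP: "Q * P = 1"
    using q_nonzero by (simp add: P_def Q_def)
  have qt: "qt = scalar_fps (Q * fps_X)" and qinvt: "qinvt = scalar_fps (P * fps_X)"
    and D: "denom_inv = scalar_fps D"
    by (simp_all add: qt_def qinvt_def denom_inv_def fps_scalar_def P_def Q_def D_def scalar_fps_mult
        scalar_fps_const \<tau>)
  have B: "(Gt oo s) * (Bm oo qinvt) = scalar_fps K * M - scalar_fps (K * Q * fps_X) * N"
      "(Gt oo s) * (Bp oo qt) = scalar_fps K * N - scalar_fps (K * P * fps_X) * M"
    using Gt_B_alpha_series[where h = h, OF h \<sigma>(2,3)]
    by (simp_all only: P_def Q_def K_def Bm_def Bp_def qt qinvt \<sigma>(1) M_def N_def)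
  \<comment> \<open>The equations \<open>B\<close> for \<open>M\<close> and \<open>N\<close> have
    determinant K^2 (1 - t^2). The sign of \<rho> cancels that in the equation for \<tau>.\<close>
  have KD: "D * K * (1 - fps_X\<^sup>2) = \<sigma>"
  proof -
    have inv: "inverse (1 + fps_X\<^sup>2) * (1 + fps_X\<^sup>2) = (1 :: 'f fps)"
      by (simp add: inverse_mult_eq_1)
    have "q\<^sup>2 - p\<^sup>2 = (q - p) * (q + p)"
      by (simp add: power2_eq_square algebra_simps)
    moreover have "inverse (a * b) * (- (a * b * (a * b)) / a) = - b" if "a \<noteq> 0" "b \<noteq> 0" for a b :: 'f
      using that by (simp add: field_simps)
    ultimately have "inverse (q\<^sup>2 - p\<^sup>2) * (\<rho> / (q - p)) = - (q + p)"
      using q_minus_inverse_nonzero q_plus_inverse_nonzero by (simp only: rho_eq)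
    then have c: "fps_const (inverse (q\<^sup>2 - p\<^sup>2)) * fps_const (\<rho> / (q - p)) = - fps_const (q + p)"
      by simp
    show ?thesis
      unfolding D_def K_def using inv c \<sigma>(3) \<tau>(2) by algebra
  qed
  have D_right: "F * (H * denom_inv) = scalar_fps D * (F * H)" for F H
    unfolding D by (metis mult.assoc scalar_fps_central)
  have "(Gt oo s) * ((qt * (Bp oo qt) + (Bm oo qinvt)) * denom_inv) =
      scalar_fps D * (scalar_fps (Q * fps_X) * ((Gt oo s) * (Bp oo qt)) + (Gt oo s) * (Bm oo qinvt))"
    by (simp only: D_right distrib_left mult_scalar_fps_left[of "Gt oo s"] qt)
  \<comment> \<open>Adding q t times the second equation to the first eliminates
    \<open>N\<close>.\<close>
  also have "\<dots> = scalar_fps (D * K) * M - scalar_fps (D * (Q * fps_X * (K * P * fps_X))) * M"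
    unfolding B by (simp only: distrib_left right_diff_distrib flip: mult.assoc scalar_fps_mult)
      (simp add: mult_ac)
  also have "\<dots> = scalar_fps (D * K - D * (Q * fps_X * (K * P * fps_X))) * M"
    by (simp only: scalar_fps_diff left_diff_distrib)
  also have "D * K - D * (Q * fps_X * (K * P * fps_X)) = \<sigma>"
    using QP KD by algebra
  finally show "s * (Wm oo s) = (Gt oo s) * ((qt * (Bp oo qt) + (Bm oo qinvt)) * denom_inv)"
    by (simp only: \<sigma>(1) M_def)
  have "(Gt oo s) * (((Bp oo qt) + qinvt * (Bm oo qinvt)) * denom_inv) =
      scalar_fps D * ((Gt oo s) * (Bp oo qt) + scalar_fps (P * fps_X) * ((Gt oo s) * (Bm oo qinvt)))"
    by (simp only: D_right distrib_left mult_scalar_fps_left[of "Gt oo s"] qinvt)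
  \<comment> \<open>Adding t/q times the first equation to the second eliminates
    \<open>M\<close>.\<close>
  also have "\<dots> = scalar_fps (D * K) * N - scalar_fps (D * (P * fps_X * (K * Q * fps_X))) * N"
    unfolding B by (simp only: distrib_left right_diff_distrib flip: mult.assoc scalar_fps_mult)
      (simp add: mult_ac)
  also have "\<dots> = scalar_fps (D * K - D * (P * fps_X * (K * Q * fps_X))) * N"
    by (simp only: scalar_fps_diff left_diff_distrib)
  also have "D * K - D * (P * fps_X * (K * Q * fps_X)) = \<sigma>"
    using QP KD by algebra
  finally show "s * (Wp oo s) = (Gt oo s) * (((Bp oo qt) + qinvt * (Bm oo qinvt)) * denom_inv)"
    by (simp only: \<sigma>(1) N_def)
qed

end

section \<open>From the presentation to the relations of the locale\<close>

lemma alternating_relations_presented: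
  assumes "presented_algebra scale g (alt_rels q)" "q \<noteq> 0" "q ^ 4 \<noteq> 1"
  shows "alternating_relations scale q g"
proof -
  interpret unital_algebra scale
    using assms(1) by (simp add: presented_algebra_def)
  have rel: "free_eval scale g l = free_eval scale g r" if "(l, r) \<in> alt_rels q" for l r
    using presented_algebra_relation[OF assms(1) that] .
  have ev: "free_eval scale g (rcomm free_scale q x y) =
      rcomm scale q (free_eval scale g x) (free_eval scale g y)"
      "free_eval scale g (comm x y) = comm (free_eval scale g x) (free_eval scale g y)" for x y
    by (simp_all add: rcomm_def comm_def free_eval_simps)
  have \<rho>: "- ((q\<^sup>2 - inverse q ^ 2)\<^sup>2) = - ((q powi 2 - q powi (-2)) ^ 2)"
    by (simp add: power_int_minus power_inverse)
  let ?w = "\<lambda>n. free_gen (CW n)" and ?G = "\<lambda>n. free_gen (CG n)" and ?H = "\<lambda>n. free_gen (CGt n)"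
  let ?s = "free_scale (- ((q powi 2 - q powi (-2)) ^ 2))"
  have mem:
    "(comm (?w 0) (?w (int k + 1)), free_scale (inverse (q + inverse q)) (?H k - ?G k)) \<in> alt_rels q"
    "(comm (?w (- int k)) (?w 1), free_scale (inverse (q + inverse q)) (?H k - ?G k)) \<in> alt_rels q"
    "(rcomm free_scale q (?w 0) (?G k), ?s (?w (- int (Suc k))) - ?s (?w (int k + 1))) \<in> alt_rels q"
    "(rcomm free_scale q (?H k) (?w 0), ?s (?w (- int (Suc k))) - ?s (?w (int k + 1))) \<in> alt_rels q"
    "(rcomm free_scale q (?G k) (?w 1), ?s (?w (2 + int k)) - ?s (?w (- int k))) \<in> alt_rels q"
    "(rcomm free_scale q (?w 1) (?H k), ?s (?w (2 + int k)) - ?s (?w (- int k))) \<in> alt_rels q" for k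
    unfolding alt_rels_def Let_def
    by (rule UnI1, rule UN_I[where a = k, OF UNIV_I], simp)+
  have mem':
    "(comm (?w (- int k)) (?w (- int l)), 0) \<in> alt_rels q"
    "(comm (?w (int k + 1)) (?w (int l + 1)), 0) \<in> alt_rels q" for k l
    unfolding alt_rels_def Let_def
    by (rule UnI2, rule UN_I[where a = k, OF UNIV_I], rule UN_I[where a = l, OF UNIV_I], simp)+
  \<comment> \<open>Folding gathers the two \<rho> terms under one scalar, the form that the locale
    assumes.\<close>
  note rels = mem[THEN rel, unfolded ev free_eval_simps, folded \<rho> scale_right_diff_distrib]
    mem'[THEN rel, unfolded ev free_eval_simps free_eval_zero]
  show ?thesis
    using assms(2,3) rels(1-6) rels(7)[of 0] rels(8)[of _ 0]
    by unfold_locales (simp_all add: add.commute)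
qed

theorem theorem9p9:
  fixes q :: "'f::field"
    and sO :: "'f \<Rightarrow> 'o::ring_1 \<Rightarrow> 'o" and gO :: "onsager_gen \<Rightarrow> 'o"
    and sA :: "'f \<Rightarrow> 'a::ring_1 \<Rightarrow> 'a" and gA :: "alt_gen \<Rightarrow> 'a"
    and \<iota> :: "'o \<Rightarrow> 'a"
  assumes q_nonzero: "q \<noteq> 0"
    and q_not_root_of_unity: "\<forall>n::nat. n > 0 \<longrightarrow> q ^ n \<noteq> 1"
    and Oq: "presented_algebra sO gO (onsager_rels q)"
    and calOq: "presented_algebra sA gA (alt_rels q)"
    and iota_hom: "algebra_hom sO sA \<iota>"
    and iota_inj: "inj \<iota>"
    and iota_W0: "\<iota> (gO W0) = gA (CW 0)"
    and iota_W1: "\<iota> (gO W1) = gA (CW 1)"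
  defines "Bminus \<equiv> Abs_fps (\<lambda>n. \<iota> (B_alpha0 sO q gO n))"
    and "Bplus \<equiv> Abs_fps (\<lambda>n. \<iota> (B_alpha1 sO q gO n))"
    and "s \<equiv> subst_arg sA q"
    and "qt \<equiv> fps_scalar sA q * fps_X"
    and "qinvt \<equiv> fps_scalar sA (inverse q) * fps_X"
    and "denom_inv \<equiv> fps_scalar sA (inverse (q powi 2 - q powi (-2))) * inv_t_minus_tinv"
  shows "s * (Wminus_series gA oo s) =
           (Gt_series sA q gA oo s) *
             ((qt * (Bplus oo qt) + (Bminus oo qinvt)) * denom_inv)
       \<and> s * (Wplus_series gA oo s) =
           (Gt_series sA q gA oo s) *
             (((Bplus oo qt) + qinvt * (Bminus oo qinvt)) * denom_inv)"
proof -
  have "q ^ 4 \<noteq> 1"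
    using q_not_root_of_unity by simp
  then interpret alternating_relations sA q gA "- ((q\<^sup>2 - inverse q ^ 2)\<^sup>2)"
    using alternating_relations_presented[OF calOq q_nonzero] by simp
  have d: "q powi 2 - q powi (-2) = q\<^sup>2 - inverse q ^ 2"
    by (simp add: power_int_minus power_inverse)
  show ?thesis
    \<comment> \<open>The images of the root vectors satisfy the recursions started from
      \<iota>(W_0) and \<iota>(W_1), which are the generators W_0 and W_1 of the target.\<close>
    using alternating_series_eq[of "\<lambda>x. \<iota> (gO x)", OF iota_W0 iota_W1]
    unfolding Bminus_def Bplus_def s_def qt_def qinvt_def denom_inv_def d
      algebra_hom_B_alpha[OF iota_hom]
    by blast
qed

end
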